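(* Suppose $\sigma_S\le\sigma_C$. Then for every discount factor $\alpha\in[0,1)$ and every number of sources $n\in\{2,3,\dots\}$, the access-fair strategy $U^\infty$ is a subgame perfect Nash equilibrium of the infinitely repeated game $G^\infty$.
   Context: Stage game. There are $n\ge2$ sources $\{1,\dots,n\}$. Idle, successful-transmission and collision slots have real lengths $\sigma_I,\sigma_S,\sigma_C>0$, with $\sigma_I<\sigma_S$ and $\sigma_I<\sigma_C$. In slot $t$ with age vector $(\Delta_{1,t},\dots,\Delta_{n,t})$, each source chooses to transmit ($\mathcal T$) or idle ($\mathcal I$). The next age of source $k$ is $\Delta_{k,t+1}=\Delta_{k,t}+\sigma_I$ if nobody transmits; $\Delta_{k,t}+\sigma_C$ if at least two sources transmit; $\Delta_{k,t}+\sigma_S$ if exactly one source transmits and it is not $k$; and $\sigma_S$ if $k$ is the only transmitter. All ages are assumed to be $\ge\sigma_S$ at the beginning of every slot. Infinitely repeated game $G^\infty$. The stage game is played in slots $t=0,1,2,\dots$ starting from an age vector $(\Delta_{1,0},\dots,\Delta_{n,0})$; the age vector at the end of a slot is the state at the beginning of the next slot. The utility of source $k$ is the (expected, if play is random) discounted sum $$-(1-\alpha)\sum_{t=1}^\infty\alpha^{t-1}\Delta_{k,t},\qquad \alpha\in[0,1)\quad(0^0=1).$$ The utility in the continuation game starting at a later slot is defined in the same way from that slot on. A strategy prescribes an action for every slot and state. Strategies may be correlated: at the beginning of each slot a common signal is observed by all sources before they choose actions, and the actions may depend on it. Access-fair strategy $U^\infty$: in every slot and for every age vector, the common signal selects one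 source uniformly at random (probability $1/n$ each, independently across slots); the selected source transmits and all other sources idle. Subgame perfect Nash equilibrium (SPNE): a profile of repeated-game strategies such that, given any slot, any age vector (all ages $\ge\sigma_S$) at its beginning and any realization of that slot's common signal, the continuation strategies from that slot onward form a Nash equilibrium of the continuation game, i.e. no single source can strictly increase its expected discounted utility in the continuation game by switching to another strategy while all other sources follow the profile. *)

theory Defs
  imports "HOL-Probability.Probability"
begin

datatype action = Transmit | Idle

text \<open>The sources are the elements of a finite type \<open>'n\<close>, so their number is \<open>CARD('n)\<close>.\<close>

type_synonym 'n ages = "'n \<Rightarrow> real"

definition next_ages :: "real \<Rightarrow> real \<Rightarrow> real \<Rightarrow> ('n \<Rightarrow> action) \<Rightarrow> 'n ages \<Rightarrow> 'n ages" where
  "next_ages \<sigma>I \<sigma>S \<sigma>C a \<Delta> = (\<lambda>k.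
     let T = {j. a j = Transmit} in
       if T = {} then \<Delta> k + \<sigma>I
       else if T = {k} then \<sigma>S
       else if \<exists>j. T = {j} then \<Delta> k + \<sigma>S
       else \<Delta> k + \<sigma>C)"

text \<open>A strategy prescribes, for each slot, age vector and common signal, an action. The action may
  be privately randomized, hence the \<open>pmf\<close>; pure strategies are the ones whose values are
  \<open>return_pmf\<close>.\<close>

type_synonym ('n, 's) strategy = "nat \<Rightarrow> 'n ages \<Rightarrow> 's \<Rightarrow> action pmf"

text \<open>Private randomization is driven by draws that are uniform on the unit interval and independent
  over sources and slots: a draw \<open>u\<close> is turned into an action with distribution \<open>p\<close>.\<close>

definition unif :: "real measure" where
  "unif = uniform_measure lborel {0..<1}"

definition draw_action :: "action pmf \<Rightarrow> real \<Rightarrow> action" where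
  "draw_action p u = (if u < pmf p Transmit then Transmit else Idle)"

lemma measure_draw_action: "measure unif {u. draw_action p u = a} = pmf p a"
proof -
  have U: "UNIV = {Transmit, Idle}"
    using action.exhaust by auto
  have s: "pmf p Transmit + pmf p Idle = 1"
  proof -
    have "sum (pmf p) {Transmit, Idle} = 1"
      by (rule sum_pmf_eq_1) (simp, simp flip: U)
    then show ?thesis by simp
  qed
  have le: "pmf p Transmit \<le> 1"
    by (rule pmf_le_1)
  have *: "measure unif A = measure lborel ({0..<1} \<inter> A)" if "A \<in> sets borel" for A :: "real set"
    using that by (simp add: unif_def measure_def divide_ennreal_def)
  show ?thesis
  proof (cases a)
    case Transmit
    have "{u. draw_action p u = a} = {..<pmf p Transmit}"
      using Transmit by (auto simp: draw_action_def)
    moreover have "{0..<1} \<inter> {..<pmf p Transmit} = {0..<pmf p Transmit}"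
      using le by auto
    ultimately show ?thesis
      using Transmit by (simp add: *)
  next
    case Idle
    have "{u. draw_action p u = a} = {pmf p Transmit..}"
      using Idle by (auto simp: draw_action_def)
    moreover have "{0..<1} \<inter> {pmf p Transmit..} = {pmf p Transmit..<1}"
      using pmf_nonneg[of p Transmit] by (auto simp del: pmf_nonneg)
    ultimately show ?thesis
      using Idle le s by (simp add: *)
  qed
qed

text \<open>The play from slot \<open>t\<close> on, starting with ages \<open>\<Delta>\<close>. Index \<open>i\<close> stands for slot \<open>t + i\<close>, whose common
  signal is \<open>\<xi> i\<close> and in which source \<open>j\<close> has the private draw \<open>\<upsilon> (i, j)\<close>; the value at \<open>i\<close> is
  the age vector at the beginning of slot \<open>t + i\<close>.\<close>

primrec play :: "real \<Rightarrow> real \<Rightarrow> real \<Rightarrow> ('n \<Rightarrow> ('n, 's) strategy) \<Rightarrow> nat \<Rightarrow> 'n ages \<Rightarrow>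
    (nat \<Rightarrow> 's) \<Rightarrow> (nat \<times> 'n \<Rightarrow> real) \<Rightarrow> nat \<Rightarrow> 'n ages" where
  "play \<sigma>I \<sigma>S \<sigma>C f t \<Delta> \<xi> \<upsilon> 0 = \<Delta>"
| "play \<sigma>I \<sigma>S \<sigma>C f t \<Delta> \<xi> \<upsilon> (Suc i) =
     (let \<Delta>' = play \<sigma>I \<sigma>S \<sigma>C f t \<Delta> \<xi> \<upsilon> i in
      next_ages \<sigma>I \<sigma>S \<sigma>C (\<lambda>j. draw_action (f j (t + i) \<Delta>' (\<xi> i)) (\<upsilon> (i, j))) \<Delta>')"

text \<open>The joint law of signals and private draws from slot \<open>t\<close> on, given that the signal of slot \<open>t\<close>
  has been realized as \<open>s\<close>. The signal of slot \<open>t\<close> has law \<open>\<mu> t\<close>, independently over slots.\<close>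

definition continuation_space ::
    "(nat \<Rightarrow> 's pmf) \<Rightarrow> nat \<Rightarrow> 's \<Rightarrow> ((nat \<Rightarrow> 's) \<times> (nat \<times> 'n \<Rightarrow> real)) measure" where
  "continuation_space \<mu> t s =
     (\<Pi>\<^sub>M i\<in>UNIV. measure_pmf (if i = 0 then return_pmf s else \<mu> (t + i))) \<Otimes>\<^sub>M (\<Pi>\<^sub>M ij\<in>UNIV. unif)"

definition discounted_utility :: "real \<Rightarrow> (nat \<Rightarrow> 'n ages) \<Rightarrow> 'n \<Rightarrow> real" where
  "discounted_utility \<alpha> D k = - (1 - \<alpha>) * (\<Sum>i. \<alpha> ^ i * D (Suc i) k)"

definition continuation_utility :: "real \<Rightarrow> real \<Rightarrow> real \<Rightarrow> real \<Rightarrow> (nat \<Rightarrow> 's pmf) \<Rightarrow>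
    ('n \<Rightarrow> ('n, 's) strategy) \<Rightarrow> nat \<Rightarrow> 'n ages \<Rightarrow> 's \<Rightarrow> 'n \<Rightarrow> real" where
  "continuation_utility \<sigma>I \<sigma>S \<sigma>C \<alpha> \<mu> f t \<Delta> s k =
     (\<integral>(\<xi>, \<upsilon>). discounted_utility \<alpha> (play \<sigma>I \<sigma>S \<sigma>C f t \<Delta> \<xi> \<upsilon>) k \<partial>continuation_space \<mu> t s)"

definition continuation_Nash :: "real \<Rightarrow> real \<Rightarrow> real \<Rightarrow> real \<Rightarrow> (nat \<Rightarrow> 's pmf) \<Rightarrow>
    ('n \<Rightarrow> ('n, 's) strategy) \<Rightarrow> nat \<Rightarrow> 'n ages \<Rightarrow> 's \<Rightarrow> bool" where
  "continuation_Nash \<sigma>I \<sigma>S \<sigma>C \<alpha> \<mu> f t \<Delta> s \<longleftrightarrow>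
     (\<forall>k g. \<not> continuation_utility \<sigma>I \<sigma>S \<sigma>C \<alpha> \<mu> (f(k := g)) t \<Delta> s k
              > continuation_utility \<sigma>I \<sigma>S \<sigma>C \<alpha> \<mu> f t \<Delta> s k)"

text \<open>A correlated strategy profile consists of the laws \<open>\<mu>\<close> of the common signals and one strategy
  \<open>f j\<close> for each source \<open>j\<close>.\<close>

definition SPNE :: "real \<Rightarrow> real \<Rightarrow> real \<Rightarrow> real \<Rightarrow> (nat \<Rightarrow> 's pmf) \<Rightarrow>
    ('n \<Rightarrow> ('n, 's) strategy) \<Rightarrow> bool" where
  "SPNE \<sigma>I \<sigma>S \<sigma>C \<alpha> \<mu> f \<longleftrightarrow>
     (\<forall>t \<Delta>. \<forall>s \<in> set_pmf (\<mu> t). (\<forall>j. \<sigma>S \<le> \<Delta> j) \<longrightarrow> continuation_Nash \<sigma>I \<sigma>S \<sigma>C \<alpha> \<mu> f t \<Delta> s)"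

definition access_fair_signal :: "nat \<Rightarrow> 'n::finite pmf" where
  "access_fair_signal t = pmf_of_set UNIV"

definition access_fair :: "'n \<Rightarrow> ('n, 'n) strategy" where
  "access_fair j t \<Delta> s = return_pmf (if j = s then Transmit else Idle)"

end

theory Submission imports Defs begin

text \<open>Almost surely in the signals and draws, a deviation never lowers the deviator's age in any slot.
  If the deviator is selected, conforming resets its age to \<open>\<sigma>S\<close>, whereas idling leads to at least
  \<open>\<sigma>S + \<sigma>I\<close>; if another source is selected, conforming adds \<open>\<sigma>S\<close>, whereas transmitting adds
  \<open>\<sigma>C \<ge> \<sigma>S\<close>. Both updates are monotone in the current age, so the comparison propagates along
  the play.\<close>

text \<open>Finiteness of actions, and hence of action profiles over a finite type of sources, is
  what keeps the set of ages reachable in a given slot finite.\<close>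

instance action :: finite
proof
  have "(UNIV :: action set) = {Transmit, Idle}"
    using action.exhaust by auto
  then show "finite (UNIV :: action set)"
    by (metis finite.emptyI finite.insertI)
qed

section \<open>Law of signals and private draws\<close>

lemma sets_unif [measurable_cong, simp]: "sets unif = sets borel"
  by (simp add: unif_def)

lemma prob_space_unif: "prob_space unif"
  unfolding unif_def by (rule prob_space_uniform_measure) auto

lemma AE_unif: "AE u in unif. 0 \<le> u \<and> u < 1"
  unfolding unif_def by (rule AE_uniform_measureI) auto

lemma draw_action_measurable [measurable]: "draw_action p \<in> measurable unif (count_space UNIV)"
proof -
  have "draw_action p \<in> measurable borel (count_space UNIV)"
    unfolding draw_action_def by measurable
  then show ?thesis
    by (simp cong: measurable_cong_sets)
qed

text \<open>Both bounds matter: a draw \<open>u = 1\<close> would turn a sure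
  \<open>Transmit\<close> into \<open>Idle\<close>, and a negative draw a sure \<open>Idle\<close>
  into \<open>Transmit\<close>. Pure strategies are thus executed faithfully only almost
  surely.\<close>

lemma draw_action_return_pmf:
  assumes "0 \<le> u" "u < 1"
  shows "draw_action (return_pmf a) u = a"
  using assms by (cases a) (auto simp: draw_action_def)

lemma prob_space_continuation_space: "prob_space (continuation_space \<mu> t s)"
  unfolding continuation_space_def
  by (intro prob_space_pair prob_space_PiM prob_space_measure_pmf prob_space_unif)

text \<open>There are only countably many pairs of slot and source, so the null sets of bad draws
  combine into one. Off it, the two plays can be compared path by path.\<close>

lemma AE_continuation_space_draws:
  "AE (\<xi>, \<upsilon>) in (continuation_space \<mu> t s :: ((nat \<Rightarrow> 's) \<times> (nat \<times> 'n::finite \<Rightarrow> real)) measure).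
     \<forall>i j. 0 \<le> \<upsilon> (i, j) \<and> \<upsilon> (i, j) < 1"
proof -
  let ?S = "\<Pi>\<^sub>M i\<in>UNIV. measure_pmf (if i = 0 then return_pmf s else \<mu> (t + i))"
  let ?N = "\<Pi>\<^sub>M ij\<in>(UNIV :: (nat \<times> 'n) set). unif"
  let ?M = "continuation_space \<mu> t s :: ((nat \<Rightarrow> 's) \<times> (nat \<times> 'n \<Rightarrow> real)) measure"
  interpret S: prob_space ?S
    by (intro prob_space_PiM prob_space_measure_pmf)
  interpret N: prob_space ?N
    by (intro prob_space_PiM prob_space_unif)
  interpret pair_prob_space ?S ?N ..
  have "AE \<omega> in ?M. 0 \<le> snd \<omega> ij \<and> snd \<omega> ij < 1" for ij
    unfolding continuation_space_def
  proof (rule AE_pair_measure)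
    have "AE y in ?N. 0 \<le> y ij \<and> y ij < 1"
      by (rule AE_PiM_component[OF prob_space_unif _ AE_unif]) simp
    then show "AE x in ?S. AE y in ?N. 0 \<le> snd (x, y) ij \<and> snd (x, y) ij < 1"
      by simp
  qed measurable
  then have "AE \<omega> in ?M. \<forall>ij. 0 \<le> snd \<omega> ij \<and> snd \<omega> ij < 1"
    by (simp add: AE_all_countable)
  then show ?thesis
    by (auto simp: split_beta')
qed

section \<open>Measurability of the play\<close>

lemma next_ages_measurable:
  fixes f :: "'n::finite \<Rightarrow> ('n, 's::finite) strategy"
  shows "(\<lambda>(\<xi>, \<upsilon>). next_ages \<sigma>I \<sigma>S \<sigma>C (\<lambda>j. draw_action (f j m \<Delta> (\<xi> i)) (\<upsilon> (i, j))) \<Delta>)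
    \<in> measurable (continuation_space \<mu> t s)
        (count_space (range (\<lambda>a. next_ages \<sigma>I \<sigma>S \<sigma>C a \<Delta>)))"
    (is "_ \<in> measurable ?M _")
proof -
  have draw: "(\<lambda>\<omega>. draw_action (f j m \<Delta> (fst \<omega> i)) (snd \<omega> (i, j))) \<in> measurable ?M (count_space UNIV)" for j
  \<comment> \<open>Split over the finitely many signal values: once the signal is fixed, so is the
    distribution prescribed by \<open>f\<close>, and the action is a threshold function of the
    draw.\<close>
  proof (rule measurable_compose_countable'[where I = UNIV and g = "\<lambda>\<omega>. fst \<omega> i"])
    show "(\<lambda>\<omega>. draw_action (f j m \<Delta> x) (snd \<omega> (i, j))) \<in> measurable ?M (count_space UNIV)" for x
      unfolding continuation_space_def by measurable
    show "(\<lambda>\<omega>. fst \<omega> i) \<in> measurable ?M (count_space UNIV)"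
      unfolding continuation_space_def by measurable
  qed auto
  let ?A = "\<lambda>\<omega> j. draw_action (f j m \<Delta> (fst \<omega> i)) (snd \<omega> (i, j))"
  have "?A \<in> measurable ?M (count_space UNIV)"
  proof (subst measurable_count_space_eq2_countable, safe)
    fix a :: "'n \<Rightarrow> action"
    have "?A -` {a} \<inter> space ?M = {\<omega>\<in>space ?M. \<forall>j\<in>UNIV. ?A \<omega> j = a j}"
      by (auto simp: fun_eq_iff)
    also have "\<dots> \<in> sets ?M"
      using draw by measurable
    finally show "?A -` {a} \<inter> space ?M \<in> sets ?M" .
  qed auto
  then have "(\<lambda>\<omega>. next_ages \<sigma>I \<sigma>S \<sigma>C (?A \<omega>) \<Delta>) \<in> measurable ?M
      (count_space (range (\<lambda>a. next_ages \<sigma>I \<sigma>S \<sigma>C a \<Delta>)))"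
    by (rule measurable_compose) auto
  then show ?thesis
    by (simp add: split_beta')
qed

text \<open>Strategies need not be measurable in the ages; the play is measurable nevertheless, because
  only finitely many age vectors can be reached in a given slot. This rules out deviations whose
  utility would be the junk value 0 of a non-integrable function.\<close>

lemma play_measurable_reachable:
  fixes f :: "'n::finite \<Rightarrow> ('n, 's::finite) strategy"
  shows "\<exists>R. finite R \<and> (\<lambda>(\<xi>, \<upsilon>). play \<sigma>I \<sigma>S \<sigma>C f t \<Delta> \<xi> \<upsilon> i)
    \<in> measurable (continuation_space \<mu> t s) (count_space R)"
    (is "\<exists>R. finite R \<and> _ \<in> measurable ?M _")
proof (induction i)
  case 0
  show ?case
    by (intro exI[of _ "{\<Delta>}"]) (auto simp: split_beta')
next
  case (Suc i)
  then obtain R where R: "finite R"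
    and play: "(\<lambda>\<omega>. play \<sigma>I \<sigma>S \<sigma>C f t \<Delta> (fst \<omega>) (snd \<omega>) i) \<in> measurable ?M (count_space R)"
    by (auto simp: split_beta')
  let ?R = "(\<lambda>(a, \<Delta>). next_ages \<sigma>I \<sigma>S \<sigma>C a \<Delta>) ` (UNIV \<times> R)"
  let ?step = "\<lambda>\<Delta>' \<omega>. next_ages \<sigma>I \<sigma>S \<sigma>C
    (\<lambda>j. draw_action (f j (t + i) \<Delta>' (fst \<omega> i)) (snd \<omega> (i, j))) \<Delta>'"
  have "(\<lambda>\<omega>. ?step (play \<sigma>I \<sigma>S \<sigma>C f t \<Delta> (fst \<omega>) (snd \<omega>) i) \<omega>) \<in> measurable ?M (count_space ?R)"
  \<comment> \<open>The same splitting, now over the current age vector, which ranges over the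
    finite set \<open>R\<close> of the induction hypothesis.\<close>
  proof (rule measurable_compose_countable'[OF _ play])
    fix \<Delta>' assume "\<Delta>' \<in> R"
    then have "(\<lambda>x. x) \<in> measurable (count_space (range (\<lambda>a. next_ages \<sigma>I \<sigma>S \<sigma>C a \<Delta>'))) (count_space ?R)"
      by auto
    then show "?step \<Delta>' \<in> measurable ?M (count_space ?R)"
      by (rule measurable_compose[OF next_ages_measurable[unfolded split_beta']])
  qed (simp add: R countable_finite)
  then show ?case
    using R by (intro exI[of _ ?R]) (simp add: Let_def split_beta')
qed

lemma play_measurable:
  fixes f :: "'n::finite \<Rightarrow> ('n, 's::finite) strategy"
  shows "(\<lambda>(\<xi>, \<upsilon>). play \<sigma>I \<sigma>S \<sigma>C f t \<Delta> \<xi> \<upsilon> i k) \<in> borel_measurable (continuation_space \<mu> t s)"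
proof -
  obtain R where "(\<lambda>(\<xi>, \<upsilon>). play \<sigma>I \<sigma>S \<sigma>C f t \<Delta> \<xi> \<upsilon> i)
      \<in> measurable (continuation_space \<mu> t s) (count_space R)"
    using play_measurable_reachable by blast
  then have "(\<lambda>\<omega>. (case \<omega> of (\<xi>, \<upsilon>) \<Rightarrow> play \<sigma>I \<sigma>S \<sigma>C f t \<Delta> \<xi> \<upsilon> i) k)
      \<in> borel_measurable (continuation_space \<mu> t s)"
    by (rule measurable_compose) auto
  then show ?thesis
    by (simp add: split_beta')
qed

section \<open>Growth of ages and integrability of utilities\<close>

lemma play_bound:
  assumes "\<sigma>I > 0" "\<sigma>S > 0" "\<sigma>C > 0"
  shows "\<bar>play \<sigma>I \<sigma>S \<sigma>C f t \<Delta> \<xi> \<upsilon> i k\<bar> \<le> \<bar>\<Delta> k\<bar> + real i * (\<sigma>I + \<sigma>S + \<sigma>C)"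
proof (induction i)
  case (Suc i)
  \<comment> \<open>A slot adds one of the three lengths or resets the age to
    \<open>\<sigma>S\<close>; the sum of the lengths covers every case.\<close>
  have "\<bar>next_ages \<sigma>I \<sigma>S \<sigma>C a x k\<bar> \<le> \<bar>x k\<bar> + (\<sigma>I + \<sigma>S + \<sigma>C)" for a and x :: "'a ages"
  proof -
    have "next_ages \<sigma>I \<sigma>S \<sigma>C a x k \<in> {x k + \<sigma>I, \<sigma>S, x k + \<sigma>S, x k + \<sigma>C}"
      unfolding next_ages_def Let_def by (simp only: insert_iff split: if_split) blast
    then show ?thesis
      using assms by auto
  qed
  then have "\<bar>play \<sigma>I \<sigma>S \<sigma>C f t \<Delta> \<xi> \<upsilon> (Suc i) k\<bar>
      \<le> \<bar>play \<sigma>I \<sigma>S \<sigma>C f t \<Delta> \<xi> \<upsilon> i k\<bar> + (\<sigma>I + \<sigma>S + \<sigma>C)"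
    by (simp add: Let_def)
  with Suc show ?case
    by (simp add: algebra_simps)
qed simp

text \<open>Up to a geometric series this is the termwise derivative of the geometric series, whose
  radius of convergence is 1. The factor \<open>Suc i\<close> matches the utility, which weights the
  age after slot \<open>i\<close> by \<open>\<alpha> ^ i\<close>.\<close>

lemma summable_discounted_linear:
  fixes \<alpha> b c :: real
  assumes "0 \<le> \<alpha>" "\<alpha> < 1"
  shows "summable (\<lambda>i. \<alpha> ^ i * (b + real (Suc i) * c))"
proof -
  have "summable (\<lambda>i. diffs (\<lambda>_. 1) i * \<alpha> ^ i)"
    by (rule termdiff_converges[where K = 1]) (use assms in \<open>auto intro: summable_geometric\<close>)
  then have "summable (\<lambda>i. real (Suc i) * \<alpha> ^ i)"
    by (simp add: diffs_def)
  then have "summable (\<lambda>i. b * \<alpha> ^ i + c * (real (Suc i) * \<alpha> ^ i))"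
    using assms by (intro summable_add summable_mult summable_geometric) auto
  then show ?thesis
    by (simp add: algebra_simps)
qed

lemma play_discounted_bound:
  assumes "\<sigma>I > 0" "\<sigma>S > 0" "\<sigma>C > 0" "0 \<le> \<alpha>"
  shows "norm (\<alpha> ^ i * play \<sigma>I \<sigma>S \<sigma>C f t \<Delta> \<xi> \<upsilon> (Suc i) k)
    \<le> \<alpha> ^ i * (\<bar>\<Delta> k\<bar> + real (Suc i) * (\<sigma>I + \<sigma>S + \<sigma>C))"
  using mult_left_mono[OF play_bound[OF assms(1-3), where i = "Suc i"], of "\<alpha> ^ i"] assms(4)
  by (simp add: abs_mult del: play.simps)

lemma play_discounted_summable:
  assumes "\<sigma>I > 0" "\<sigma>S > 0" "\<sigma>C > 0" "0 \<le> \<alpha>" "\<alpha> < 1"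
  shows "summable (\<lambda>i. norm (\<alpha> ^ i * play \<sigma>I \<sigma>S \<sigma>C f t \<Delta> \<xi> \<upsilon> (Suc i) k))"
  by (rule summable_comparison_test'[OF summable_discounted_linear[OF assms(4,5)]])
    (use play_discounted_bound[OF assms(1-4)] in \<open>simp del: play.simps\<close>)

text \<open>Ages grow at most linearly whatever the signals and draws, so the discounted sum is
  bounded by a constant on a probability space. This covers every profile \<open>f\<close>, in
  particular one with an arbitrary deviation.\<close>

lemma discounted_utility_integrable:
  fixes f :: "'n::finite \<Rightarrow> ('n, 's::finite) strategy"
  assumes "\<sigma>I > 0" "\<sigma>S > 0" "\<sigma>C > 0" "0 \<le> \<alpha>" "\<alpha> < 1"
  shows "integrable (continuation_space \<mu> t s)
    (\<lambda>(\<xi>, \<upsilon>). discounted_utility \<alpha> (play \<sigma>I \<sigma>S \<sigma>C f t \<Delta> \<xi> \<upsilon>) k)"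
proof -
  interpret prob_space "continuation_space \<mu> t s :: ((nat \<Rightarrow> 's) \<times> (nat \<times> 'n \<Rightarrow> real)) measure"
    by (rule prob_space_continuation_space)
  let ?p = "\<lambda>\<omega>. play \<sigma>I \<sigma>S \<sigma>C f t \<Delta> (fst \<omega>) (snd \<omega>)"
  let ?B = "\<Sum>i. \<alpha> ^ i * (\<bar>\<Delta> k\<bar> + real (Suc i) * (\<sigma>I + \<sigma>S + \<sigma>C))"
  have [measurable]: "(\<lambda>\<omega>. ?p \<omega> i k) \<in> borel_measurable (continuation_space \<mu> t s)" for i
    using play_measurable[of \<sigma>I \<sigma>S \<sigma>C f t \<Delta> i k] by (simp add: split_beta')
  have "norm (\<Sum>i. \<alpha> ^ i * ?p \<omega> (Suc i) k) \<le> ?B" for \<omega>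
    by (rule norm_suminf_le[OF play_discounted_bound summable_discounted_linear]) (use assms in auto)
  then have "integrable (continuation_space \<mu> t s) (\<lambda>\<omega>. \<Sum>i. \<alpha> ^ i * ?p \<omega> (Suc i) k)"
    by (intro integrable_const_bound[where B = ?B] borel_measurable_suminf AE_I2) 
      (auto simp del: play.simps)
  then show ?thesis
    by (simp add: discounted_utility_def split_beta' del: play.simps)
qed

section \<open>Comparison of conforming and deviating play\<close>

lemma next_ages_single:
  assumes "\<And>j. a j = (if j = s then Transmit else Idle)"
  shows "next_ages \<sigma>I \<sigma>S \<sigma>C a \<Delta> k = (if s = k then \<sigma>S else \<Delta> k + \<sigma>S)"
proof -
  have "{j. a j = Transmit} = {s}"
    using assms by auto
  then show ?thesis
    by (auto simp: next_ages_def)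
qed

text \<open>Only the action of \<open>k\<close> is free, so the set of transmitters is
  \<open>{s, k}\<close> or \<open>{s} - {k}\<close>. The first collapses to \<open>{k}\<close> when
  \<open>s = k\<close>, and the second is then empty.\<close>

lemma next_ages_single_deviation:
  assumes "\<And>j. j \<noteq> k \<Longrightarrow> a j = (if j = s then Transmit else Idle)"
    and "\<sigma>I > 0" "\<sigma>S \<le> \<sigma>C" "\<sigma>S \<le> \<Delta> k"
  shows "(if s = k then \<sigma>S else \<Delta> k + \<sigma>S) \<le> next_ages \<sigma>I \<sigma>S \<sigma>C a \<Delta> k"
proof (cases "a k")
  case Transmit
  then have "a j = Transmit \<longleftrightarrow> j \<in> {s, k}" for j
    using assms(1)[of j] by (cases "j = k") auto
  then have "{j. a j = Transmit} = {s, k}"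
    by blast
  then show ?thesis
    using assms by (auto simp: next_ages_def Let_def)
next
  case Idle
  then have "a j = Transmit \<longleftrightarrow> j \<in> {s} - {k}" for j
    using assms(1)[of j] by (cases "j = k") auto
  then have "{j. a j = Transmit} = {s} - {k}"
    by blast
  then show ?thesis
    using assms by (auto simp: next_ages_def Let_def)
qed

text \<open>The plays are coupled through common \<open>\<xi>\<close> and \<open>\<upsilon>\<close>.
  The lower bound \<open>\<sigma>S\<close> is carried through the induction because it passes to the
  deviating play, where an idle slot must not beat a reset.\<close>

lemma play_access_fair_le_deviation:
  fixes g :: "('n, 'n) strategy"
  assumes "\<sigma>I > 0" "\<sigma>S > 0" "\<sigma>S \<le> \<sigma>C" "\<sigma>S \<le> \<Delta> k"
    and draws: "\<And>i j. 0 \<le> \<upsilon> (i, j) \<and> \<upsilon> (i, j) < 1"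
  shows "\<sigma>S \<le> play \<sigma>I \<sigma>S \<sigma>C access_fair t \<Delta> \<xi> \<upsilon> i k \<and>
    play \<sigma>I \<sigma>S \<sigma>C access_fair t \<Delta> \<xi> \<upsilon> i k \<le> play \<sigma>I \<sigma>S \<sigma>C (access_fair(k := g)) t \<Delta> \<xi> \<upsilon> i k"
proof (induction i)
  case 0
  then show ?case
    using assms by simp
next
  case (Suc i)
  let ?p = "play \<sigma>I \<sigma>S \<sigma>C access_fair t \<Delta> \<xi> \<upsilon>"
  let ?q = "play \<sigma>I \<sigma>S \<sigma>C (access_fair(k := g)) t \<Delta> \<xi> \<upsilon>"
  \<comment> \<open>The ages \<open>x\<close> are arbitrary: although the two plays reach different
    states, the conforming sources react to the signal alone and act alike in both.\<close>
  have fair: "draw_action (access_fair j m x (\<xi> i)) (\<upsilon> (i, j)) = (if j = \<xi> i then Transmit else Idle)"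
    for j m and x :: "'n ages"
    using draws by (simp add: access_fair_def draw_action_return_pmf)
  have "?p (Suc i) k = (if \<xi> i = k then \<sigma>S else ?p i k + \<sigma>S)"
    by (simp add: Let_def next_ages_single[where s = "\<xi> i"] fair)
  moreover have "\<sigma>S \<le> ?q i k"
    using Suc by linarith
  moreover have "(if \<xi> i = k then \<sigma>S else ?q i k + \<sigma>S) \<le> ?q (Suc i) k"
    unfolding play.simps Let_def
    using assms(1,3) \<open>\<sigma>S \<le> ?q i k\<close> by (intro next_ages_single_deviation) (simp_all add: fair)
  ultimately show ?case
    using Suc assms(2) by (smt (verit, best))
qed

theorem theorem4:
  fixes \<sigma>I \<sigma>S \<sigma>C \<alpha> :: real
  assumes "CARD('n::finite) \<ge> 2"
    and "\<sigma>I > 0" and "\<sigma>S > 0" and "\<sigma>C > 0"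
    and "\<sigma>I < \<sigma>S" and "\<sigma>I < \<sigma>C"
    and "\<sigma>S \<le> \<sigma>C"
    and "0 \<le> \<alpha>" and "\<alpha> < 1"
  shows "SPNE \<sigma>I \<sigma>S \<sigma>C \<alpha> (access_fair_signal :: nat \<Rightarrow> 'n pmf) access_fair"
  unfolding SPNE_def continuation_Nash_def
proof (intro allI ballI impI, unfold not_less)
  fix t s k and \<Delta> :: "'n ages" and g :: "('n, 'n) strategy"
  assume ages: "\<forall>j. \<sigma>S \<le> \<Delta> j"
  let ?p = "\<lambda>f \<xi> \<upsilon>. play \<sigma>I \<sigma>S \<sigma>C f t \<Delta> \<xi> \<upsilon>"
  have "discounted_utility \<alpha> (?p (access_fair(k := g)) \<xi> \<upsilon>) k
      \<le> discounted_utility \<alpha> (?p access_fair \<xi> \<upsilon>) k"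
    if "\<forall>i j. 0 \<le> \<upsilon> (i, j) \<and> \<upsilon> (i, j) < 1" for \<xi> \<upsilon>
  proof -
    have "(\<Sum>i. \<alpha> ^ i * ?p access_fair \<xi> \<upsilon> (Suc i) k)
        \<le> (\<Sum>i. \<alpha> ^ i * ?p (access_fair(k := g)) \<xi> \<upsilon> (Suc i) k)"
      using assms ages that play_access_fair_le_deviation[of \<sigma>I \<sigma>S \<sigma>C \<Delta> k \<upsilon>]
      by (intro suminf_le mult_left_mono summable_norm_cancel[OF play_discounted_summable])
        (auto simp del: play.simps)
    then show ?thesis
      using assms by (simp add: discounted_utility_def mult_left_mono del: play.simps)
  qed
  \<comment> \<open>The law of signals and draws does not depend on the profile, so both utilities
    are integrals over the same space and the pathwise inequality can be integrated.\<close>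
  then have "AE \<omega> in continuation_space access_fair_signal t s.
      (case \<omega> of (\<xi>, \<upsilon>) \<Rightarrow> discounted_utility \<alpha> (?p (access_fair(k := g)) \<xi> \<upsilon>) k)
      \<le> (case \<omega> of (\<xi>, \<upsilon>) \<Rightarrow> discounted_utility \<alpha> (?p access_fair \<xi> \<upsilon>) k)"
    by (intro eventually_mono[OF AE_continuation_space_draws]) auto
  then show "continuation_utility \<sigma>I \<sigma>S \<sigma>C \<alpha> access_fair_signal (access_fair(k := g)) t \<Delta> s k
      \<le> continuation_utility \<sigma>I \<sigma>S \<sigma>C \<alpha> access_fair_signal access_fair t \<Delta> s k"
    unfolding continuation_utility_def using assms
    by (intro integral_mono_AE discounted_utility_integrable) auto
qed

end
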